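(* Let $n\ge 2$ be an integer and let $a,b_1,\dots,b_n$ be real numbers with $a\neq 0,-1,-2,\dots$ and $a>b_1+\dots+b_n$. Then $$\sum_{\substack{m_{i,j}=0\\ (2\le i\le j\le n)}}^{\infty}\frac{(a)_{A(n,n)}}{\prod_{2\le i\le j\le n} m_{i,j}!}\ \prod_{k=1}^{n}\frac{(b_k)_{B(k,n)}\,(a-b_k)_{A(k,n)-B(k,n)}}{(a)_{A(k,n)}}=\Gamma\Big(a-\sum_{k=1}^{n}b_k\Big)\frac{\Gamma^{\,n-1}(a)}{\prod_{k=1}^{n}\Gamma(a-b_k)},$$ where the sum runs over all families $(m_{i,j})_{2\le i\le j\le n}$ of non-negative integers, and $A(k,n)$, $B(k,n)$ are the non-negative integers $$A(k,n)=\sum_{i=2}^{k+1}\sum_{j=i}^{n}m_{i,j},\qquad B(k,n)=\sum_{i=2}^{k}m_{i,k}+\sum_{i=k+1}^{n}m_{k+1,i}.$$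
   Context: $\Gamma$ is the Gamma function, with the usual convention $1/\Gamma(x)=0$ for $x=0,-1,-2,\dots$. For real $\kappa$ and a non-negative integer $\nu$, $(\kappa)_\nu$ is the Pochhammer symbol (shifted factorial): $(\kappa)_0=1$ and $(\kappa)_\nu=\kappa(\kappa+1)\cdots(\kappa+\nu-1)=\Gamma(\kappa+\nu)/\Gamma(\kappa)$ for $\nu\ge1$. $\Gamma^{\,n-1}(a)$ means $(\Gamma(a))^{n-1}$. Empty sums are zero; in particular, sums over an index whose lower limit exceeds its upper limit vanish. For every $1\le k\le n$ one has $A(k,n)-B(k,n)\ge 0$, since each term of $B(k,n)$ occurs in $A(k,n)$.
   Formalization: The series can diverge for mixed signs (n=3, a=1, b=(-2,1,1): it is 1+1+1+...), so it is additionally assumed that n=2, or all b_k ≥ 0, or the multiple series over all families converges unconditionally. *)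

theory Defs
  imports "HOL-Analysis.Analysis"
begin

definition index_pairs :: "nat \<Rightarrow> (nat \<times> nat) set" where
  "index_pairs n = {(i, j). 2 \<le> i \<and> i \<le> j \<and> j \<le> n}"

text \<open>The families \<open>(m\<^sub>i\<^sub>,\<^sub>j)\<close> are the extensional functions on the index pairs (they have the
  default value elsewhere), so each family is represented exactly once.\<close>

definition families :: "nat \<Rightarrow> (nat \<times> nat \<Rightarrow> nat) set" where
  "families n = index_pairs n \<rightarrow>\<^sub>E UNIV"

definition A :: "(nat \<times> nat \<Rightarrow> nat) \<Rightarrow> nat \<Rightarrow> nat \<Rightarrow> nat" where
  "A m k n = (\<Sum>i = 2..k + 1. \<Sum>j = i..n. m (i, j))"

definition B :: "(nat \<times> nat \<Rightarrow> nat) \<Rightarrow> nat \<Rightarrow> nat \<Rightarrow> nat" where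
  "B m k n = (\<Sum>i = 2..k. m (i, k)) + (\<Sum>i = k + 1..n. m (k + 1, i))"

text \<open>Because of the following fact the truncated subtraction in \<open>A m k n - B m k n\<close> is the
  true difference for all indices that are used.\<close>

lemma B_le_A:
  assumes "1 \<le> k" "k \<le> n"
  shows "B m k n \<le> A m k n"
proof -
  have "(\<Sum>i = 2..k. m (i, k)) \<le> (\<Sum>i = 2..k. \<Sum>j = i..n. m (i, j))"
    using assms by (intro sum_mono member_le_sum) auto
  moreover have "A m k n = (\<Sum>i = 2..k. \<Sum>j = i..n. m (i, j)) + (\<Sum>j = k + 1..n. m (k + 1, j))"
    using assms by (simp add: A_def)
  ultimately show ?thesis
    by (simp add: B_def)
qed

definition series_term ::
    "real \<Rightarrow> (nat \<Rightarrow> real) \<Rightarrow> nat \<Rightarrow> (nat \<times> nat \<Rightarrow> nat) \<Rightarrow> real" where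
  "series_term a b n m =
     pochhammer a (A m n n) / (\<Prod>p\<in>index_pairs n. fact (m p)) *
     (\<Prod>k = 1..n. pochhammer (b k) (B m k n) * pochhammer (a - b k) (A m k n - B m k n)
                    / pochhammer a (A m k n))"

text \<open>For parameters of mixed sign the multiple series may diverge although
  \<open>a > b\<^sub>1 + \<dots> + b\<^sub>n\<close>. For instance, if \<open>n = 3\<close>, \<open>a = b\<^sub>2 = b\<^sub>3 = 1\<close> and \<open>b\<^sub>1 = -2\<close>, then the term of
  a family is 1 if \<open>m\<^sub>2\<^sub>,\<^sub>2 = m\<^sub>2\<^sub>,\<^sub>3 = 0\<close> and 0 otherwise, so the series is \<open>1 + 1 + 1 + \<dots>\<close>.
  Convergence is therefore a separate hypothesis of the summation theorem; it is needed only
  where neither the non-negativity of all \<open>b\<^sub>k\<close> nor \<open>n = 2\<close> (Gauss's theorem) ensures it.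

  On the right-hand side of the theorem, \<open>Gamma x = 0\<close> at the poles together with \<open>x / 0 = 0\<close>
  realises the convention \<open>1 / \<Gamma>(x) = 0\<close> for \<open>x = 0, -1, -2, \<dots>\<close>.\<close>

end

theory Submission
  imports Defs "HOL-Real_Asymp.Real_Asymp"
begin

text \<open>The proof is by induction on \<open>n\<close>; each step removes one parameter. Group the families for
  \<open>n + 1\<close> by the family for \<open>n\<close> that arises from adding columns \<open>n\<close> and \<open>n + 1\<close> entrywise
  (for \<open>2 \<le> i \<le> n\<close>) and deleting the corner entry \<open>q = m\<^sub>n\<^sub>+\<^sub>1\<^sub>,\<^sub>n\<^sub>+\<^sub>1\<close>. Within a group the term depends
  on \<open>q\<close> as in Gauss's series \<open>F(b\<^sub>n + C, b\<^sub>n\<^sub>+\<^sub>1 + D; a + N; 1)\<close>, where \<open>C\<close> and \<open>D\<close> are the sums of the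
  columns \<open>n\<close> and \<open>n + 1\<close> without the corner and \<open>N\<close> is the sum of all entries but the corner. Gauss's
  summation theorem evaluates it. Because of the factors \<open>(a - b\<^sub>n)\<^sub>N\<^sub>-\<^sub>C\<close> and \<open>(a - b\<^sub>n\<^sub>+\<^sub>1)\<^sub>N\<^sub>-\<^sub>D\<close> the
  result is \<open>K (b\<^sub>n)\<^sub>C (b\<^sub>n\<^sub>+\<^sub>1)\<^sub>D (a - b\<^sub>n - b\<^sub>n\<^sub>+\<^sub>1)\<^sub>N\<^sub>-\<^sub>C\<^sub>-\<^sub>D\<close> with
  \<open>K = \<Gamma>(a) \<Gamma>(a - b\<^sub>n - b\<^sub>n\<^sub>+\<^sub>1) / (\<Gamma>(a - b\<^sub>n) \<Gamma>(a - b\<^sub>n\<^sub>+\<^sub>1))\<close> (lemma \<open>gauss_reduction\<close>).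
  The finite sum over all ways to split the entries of the merged column is a Vandermonde sum
  (lemma \<open>sum_splits_pochhammer\<close>), which merges \<open>(b\<^sub>n)\<^sub>C (b\<^sub>n\<^sub>+\<^sub>1)\<^sub>D\<close> into \<open>(b\<^sub>n + b\<^sub>n\<^sub>+\<^sub>1)\<^sub>C\<^sub>+\<^sub>D\<close>. What
  remains is \<open>K\<close> times the series for \<open>n\<close> with the last parameter \<open>b\<^sub>n + b\<^sub>n\<^sub>+\<^sub>1\<close>, and the claimed
  values obey the same recursion.

  Gauss's theorem requires \<open>b\<^sub>n + b\<^sub>n\<^sub>+\<^sub>1 < a\<close>, which does not follow from \<open>a > b\<^sub>1 + \<dots> + b\<^sub>n\<^sub>+\<^sub>1\<close> when
  the parameters have mixed signs. It does follow from summability (lemma \<open>convergence_condition\<close>),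
  unless one of \<open>b\<^sub>n\<close>, \<open>b\<^sub>n\<^sub>+\<^sub>1\<close> is a non-positive integer; in that case the inner series terminates and
  the Chu--Vandermonde identity replaces Gauss's theorem. The rearrangements are justified because
  unconditional summability over all families is known beforehand: it is a hypothesis, or follows
  from the same reduction applied to non-negative terms (lemma \<open>series_summable_nonneg\<close>), or, for
  \<open>n = 2\<close>, from the absolute convergence of Gauss's series.\<close>

section \<open>Gauss's summation theorem\<close>

text \<open>The \<open>m\<close>-th term of Gauss's hypergeometric series \<open>F(\<alpha>, \<beta>; \<gamma>; 1)\<close>.\<close>

definition gauss_term :: "real \<Rightarrow> real \<Rightarrow> real \<Rightarrow> nat \<Rightarrow> real" where
  "gauss_term \<alpha> \<beta> \<gamma> m = pochhammer \<alpha> m * pochhammer \<beta> m / (fact m * pochhammer \<gamma> m)"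

lemma pochhammer_nonzero_of_not_nonpos_Int:
  fixes x :: real
  assumes "x \<notin> \<int>\<^sub>\<le>\<^sub>0"
  shows "pochhammer x m \<noteq> 0"
  using assms by (auto simp: pochhammer_eq_0_iff)

lemma rGamma_series_powr:
  assumes "m > 0"
  shows "pochhammer z (Suc m) = rGamma_series z m * fact m * real m powr z"
  using assms by (simp add: rGamma_series_def powr_def)

text \<open>By Euler's limit formula for \<open>1 / \<Gamma>\<close> this sequence converges. It is the factor by which
  \<open>(m + 1) gauss_term \<alpha> \<beta> \<gamma> (m + 1)\<close> deviates from \<open>m powr (\<alpha> + \<beta> - \<gamma>)\<close>; see the lemma
  \<open>gauss_term_asymp\<close>.\<close>

definition gauss_ratio :: "real \<Rightarrow> real \<Rightarrow> real \<Rightarrow> nat \<Rightarrow> real" where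
  "gauss_ratio \<alpha> \<beta> \<gamma> m = rGamma_series \<alpha> m * rGamma_series \<beta> m / rGamma_series \<gamma> m"

lemma gauss_ratio_tendsto:
  assumes "\<gamma> \<notin> \<int>\<^sub>\<le>\<^sub>0"
  shows "gauss_ratio \<alpha> \<beta> \<gamma> \<longlonglongrightarrow> rGamma \<alpha> * rGamma \<beta> / rGamma \<gamma>"
  unfolding gauss_ratio_def [abs_def]
  by (intro tendsto_intros) (use assms in \<open>simp add: rGamma_eq_zero_iff\<close>)

lemma gauss_term_asymp:
  assumes "m > 0"
  shows "real (Suc m) * gauss_term \<alpha> \<beta> \<gamma> (Suc m) =
           gauss_ratio \<alpha> \<beta> \<gamma> m * real m powr (\<alpha> + \<beta> - \<gamma>)"
proof -
  have "real (Suc m) * gauss_term \<alpha> \<beta> \<gamma> (Suc m) =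
      (rGamma_series \<alpha> m * fact m * real m powr \<alpha>) * (rGamma_series \<beta> m * fact m * real m powr \<beta>)
       / (fact m * (rGamma_series \<gamma> m * fact m * real m powr \<gamma>))"
    by (simp add: gauss_term_def rGamma_series_powr[OF assms] del: of_nat_Suc)
  also have "\<dots> = gauss_ratio \<alpha> \<beta> \<gamma> m * real m powr (\<alpha> + \<beta> - \<gamma>)"
    using assms by (simp add: gauss_ratio_def powr_add powr_diff)
  finally show ?thesis .
qed

lemma gauss_term_abs_summable:
  assumes "\<gamma> \<notin> \<int>\<^sub>\<le>\<^sub>0" "\<gamma> > \<alpha> + \<beta>"
  shows "summable (\<lambda>m. norm (gauss_term \<alpha> \<beta> \<gamma> m))"
proof -
  have "Bseq (gauss_ratio \<alpha> \<beta> \<gamma>)"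
    by (rule convergent_imp_Bseq) (use gauss_ratio_tendsto[OF assms(1)] in \<open>auto simp: convergent_def\<close>)
  then obtain M where M: "\<And>m. norm (gauss_ratio \<alpha> \<beta> \<gamma> m) \<le> M" "M > 0"
    by (auto simp: Bseq_def)
  have dom: "summable (\<lambda>m. M * real m powr (\<alpha> + \<beta> - \<gamma> - 1))"
    using assms(2) by (intro summable_mult) (simp add: summable_real_powr_iff)
  have le: "norm (gauss_term \<alpha> \<beta> \<gamma> (Suc m)) \<le> M * real m powr (\<alpha> + \<beta> - \<gamma> - 1)"
    if "m \<ge> 1" for m
  proof -
    have "real m * norm (gauss_term \<alpha> \<beta> \<gamma> (Suc m)) \<le> norm (real (Suc m) * gauss_term \<alpha> \<beta> \<gamma> (Suc m))"
      by (simp add: abs_mult mult_right_mono)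
    also have "\<dots> = norm (gauss_ratio \<alpha> \<beta> \<gamma> m) * real m powr (\<alpha> + \<beta> - \<gamma>)"
      using that by (subst gauss_term_asymp) (auto simp: abs_mult)
    also have "\<dots> \<le> M * real m powr (\<alpha> + \<beta> - \<gamma>)"
      by (intro mult_right_mono M) auto
    finally have "norm (gauss_term \<alpha> \<beta> \<gamma> (Suc m)) \<le> M * real m powr (\<alpha> + \<beta> - \<gamma>) / real m"
      using that by (simp add: field_simps)
    then show ?thesis
      using that by (simp add: powr_diff[of _ "\<alpha> + \<beta> - \<gamma>" 1])
  qed
  have "summable (\<lambda>m. norm (gauss_term \<alpha> \<beta> \<gamma> (Suc m)))"
    by (rule summable_comparison_test'[OF dom, of 1]) (use le in simp)
  then show ?thesis
    by (subst (asm) summable_Suc_iff)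
qed

text \<open>When the series does not terminate, the limit of \<^const>\<open>gauss_ratio\<close> is not zero, so for
  \<open>\<alpha> + \<beta> \<ge> \<gamma>\<close> the absolute values of the terms eventually exceed a positive multiple of
  those of the harmonic series.\<close>

lemma summable_gauss_term_imp:
  assumes "\<gamma> \<notin> \<int>\<^sub>\<le>\<^sub>0" "\<alpha> \<notin> \<int>\<^sub>\<le>\<^sub>0" "\<beta> \<notin> \<int>\<^sub>\<le>\<^sub>0"
    and sum: "summable (\<lambda>m. norm (gauss_term \<alpha> \<beta> \<gamma> m))"
  shows "\<gamma> > \<alpha> + \<beta>"
proof (rule ccontr)
  assume "\<not> \<gamma> > \<alpha> + \<beta>"
  then have ge: "\<alpha> + \<beta> - \<gamma> \<ge> 0"
    by simp
  define L where "L = norm (rGamma \<alpha> * rGamma \<beta> / rGamma \<gamma>)"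
  have "L > 0"
    using assms by (simp add: L_def rGamma_eq_zero_iff)
  have "(\<lambda>m. norm (gauss_ratio \<alpha> \<beta> \<gamma> m)) \<longlonglongrightarrow> L"
    unfolding L_def by (intro tendsto_norm gauss_ratio_tendsto assms)
  then have "eventually (\<lambda>m. norm (gauss_ratio \<alpha> \<beta> \<gamma> m) > L / 2) sequentially"
    using \<open>L > 0\<close> by (intro order_tendstoD) auto
  then have "eventually (\<lambda>m. norm (L / 2 * inverse (real (Suc m))) \<le> norm (gauss_term \<alpha> \<beta> \<gamma> (Suc m))) sequentially"
    using eventually_gt_at_top[of 0]
  proof eventually_elim
    case (elim m)
    have "L / 2 * 1 \<le> norm (gauss_ratio \<alpha> \<beta> \<gamma> m) * real m powr (\<alpha> + \<beta> - \<gamma>)"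
      using elim ge \<open>L > 0\<close> by (intro mult_mono ge_one_powr_ge_zero) auto
    also have "\<dots> = norm (real (Suc m) * gauss_term \<alpha> \<beta> \<gamma> (Suc m))"
      using elim by (subst gauss_term_asymp) (auto simp: abs_mult)
    finally have "L / 2 \<le> real (Suc m) * norm (gauss_term \<alpha> \<beta> \<gamma> (Suc m))"
      by (simp add: abs_mult)
    then show ?case
      using \<open>L > 0\<close> by (simp add: field_simps del: of_nat_Suc)
  qed
  moreover have "summable (\<lambda>m. norm (gauss_term \<alpha> \<beta> \<gamma> (Suc m)))"
    using sum by (subst summable_Suc_iff)
  ultimately have "summable (\<lambda>m. L / 2 * inverse (real (Suc m)))"
    by (rule summable_comparison_test_ev)
  then have "summable (\<lambda>m. inverse (real (Suc m)))"
    using \<open>L > 0\<close> by (subst (asm) summable_cmult_iff) auto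
  then have "summable (\<lambda>m. inverse (real m))"
    by (subst (asm) summable_Suc_iff)
  then show False
    using not_summable_harmonic by blast
qed

lemma not_nonpos_Int_add_of_nat:
  fixes x :: real
  assumes "x \<notin> \<int>\<^sub>\<le>\<^sub>0"
  shows "x + real k \<notin> \<int>\<^sub>\<le>\<^sub>0"
  using assms nonpos_Ints_diff_Nats[of "x + real k" "real k"] by auto

text \<open>The contiguous relation between \<open>\<gamma>\<close> and \<open>\<gamma> + 1\<close> holds termwise up to a telescoping difference.\<close>

lemma gauss_term_contiguous:
  assumes "\<gamma> \<notin> \<int>\<^sub>\<le>\<^sub>0"
  shows "\<gamma> * (\<gamma> - \<alpha> - \<beta>) * gauss_term \<alpha> \<beta> \<gamma> m - (\<gamma> - \<alpha>) * (\<gamma> - \<beta>) * gauss_term \<alpha> \<beta> (\<gamma> + 1) m =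
           - \<gamma> * (real (Suc m) * gauss_term \<alpha> \<beta> \<gamma> (Suc m) - real m * gauss_term \<alpha> \<beta> \<gamma> m)"
proof -
  have nz: "pochhammer \<gamma> m \<noteq> 0" "\<gamma> + real m \<noteq> 0" "\<gamma> \<noteq> 0"
    using pochhammer_nonzero_of_not_nonpos_Int[OF assms] not_nonpos_Int_add_of_nat[OF assms, of m] assms by auto
  have "\<gamma> * pochhammer (\<gamma> + 1) m = pochhammer \<gamma> m * (\<gamma> + real m)"
    by (metis pochhammer_rec pochhammer_Suc)
  then have "pochhammer (\<gamma> + 1) m = pochhammer \<gamma> m * (\<gamma> + real m) / \<gamma>"
    using nz by (simp add: field_simps)
  then have shift: "gauss_term \<alpha> \<beta> (\<gamma> + 1) m * (\<gamma> + real m) = \<gamma> * gauss_term \<alpha> \<beta> \<gamma> m"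
    using nz by (simp add: gauss_term_def)
  have Suc: "(\<gamma> + real m) * (real (Suc m) * gauss_term \<alpha> \<beta> \<gamma> (Suc m)) =
      (\<alpha> + real m) * (\<beta> + real m) * gauss_term \<alpha> \<beta> \<gamma> m"
    using nz by (simp add: gauss_term_def pochhammer_Suc divide_simps del: of_nat_Suc)
  have "(\<gamma> + real m) * (\<gamma> * (\<gamma> - \<alpha> - \<beta>) * gauss_term \<alpha> \<beta> \<gamma> m
           - (\<gamma> - \<alpha>) * (\<gamma> - \<beta>) * gauss_term \<alpha> \<beta> (\<gamma> + 1) m) =
        (\<gamma> + real m) * (\<gamma> * (\<gamma> - \<alpha> - \<beta>) * gauss_term \<alpha> \<beta> \<gamma> m)
           - (\<gamma> - \<alpha>) * (\<gamma> - \<beta>) * (\<gamma> * gauss_term \<alpha> \<beta> \<gamma> m)"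
    by (simp only: shift[symmetric]) algebra
  also have "\<dots> = - \<gamma> * ((\<alpha> + real m) * (\<beta> + real m) * gauss_term \<alpha> \<beta> \<gamma> m
                          - (\<gamma> + real m) * (real m * gauss_term \<alpha> \<beta> \<gamma> m))"
    by algebra
  also have "\<dots> = (\<gamma> + real m) * (- \<gamma> * (real (Suc m) * gauss_term \<alpha> \<beta> \<gamma> (Suc m) - real m * gauss_term \<alpha> \<beta> \<gamma> m))"
    by (simp only: Suc[symmetric]) algebra
  finally show ?thesis
    by (rule mult_left_cancel[OF nz(2), THEN iffD1])
qed

lemma gauss_sum_contiguous:
  assumes "\<gamma> \<notin> \<int>\<^sub>\<le>\<^sub>0" "\<gamma> > \<alpha> + \<beta>"
  shows "\<gamma> * (\<gamma> - \<alpha> - \<beta>) * (\<Sum>m. gauss_term \<alpha> \<beta> \<gamma> m) =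
           (\<gamma> - \<alpha>) * (\<gamma> - \<beta>) * (\<Sum>m. gauss_term \<alpha> \<beta> (\<gamma> + 1) m)"
proof -
  have "(\<lambda>m. real m powr (\<alpha> + \<beta> - \<gamma>)) \<longlonglongrightarrow> 0"
    using assms by (intro tendsto_neg_powr filterlim_real_sequentially) auto
  then have "(\<lambda>m. gauss_ratio \<alpha> \<beta> \<gamma> m * real m powr (\<alpha> + \<beta> - \<gamma>)) \<longlonglongrightarrow> (rGamma \<alpha> * rGamma \<beta> / rGamma \<gamma>) * 0"
    by (intro tendsto_mult gauss_ratio_tendsto assms)
  moreover have "eventually (\<lambda>m. gauss_ratio \<alpha> \<beta> \<gamma> m * real m powr (\<alpha> + \<beta> - \<gamma>) =
      real (Suc m) * gauss_term \<alpha> \<beta> \<gamma> (Suc m)) sequentially"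
    using eventually_gt_at_top[of 0] by eventually_elim (simp only: gauss_term_asymp)
  ultimately have "(\<lambda>m. real (Suc m) * gauss_term \<alpha> \<beta> \<gamma> (Suc m)) \<longlonglongrightarrow> 0"
    using Lim_transform_eventually by fastforce
  then have "(\<lambda>m. real m * gauss_term \<alpha> \<beta> \<gamma> m) \<longlonglongrightarrow> 0"
    by (subst (asm) filterlim_sequentially_Suc)
  from telescope_sums[OF this]
  have "(\<lambda>m. - \<gamma> * (real (Suc m) * gauss_term \<alpha> \<beta> \<gamma> (Suc m) - real m * gauss_term \<alpha> \<beta> \<gamma> m)) sums (- \<gamma> * 0)"
    by (intro sums_mult) simp
  then have "(\<lambda>m. \<gamma> * (\<gamma> - \<alpha> - \<beta>) * gauss_term \<alpha> \<beta> \<gamma> m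
                - (\<gamma> - \<alpha>) * (\<gamma> - \<beta>) * gauss_term \<alpha> \<beta> (\<gamma> + 1) m) sums 0"
    by (subst gauss_term_contiguous[OF assms(1)]) simp
  moreover have "summable (gauss_term \<alpha> \<beta> \<gamma>)"
    using gauss_term_abs_summable[OF assms] by (rule summable_norm_cancel)
  then have s1: "(\<lambda>m. \<gamma> * (\<gamma> - \<alpha> - \<beta>) * gauss_term \<alpha> \<beta> \<gamma> m) sums
       (\<gamma> * (\<gamma> - \<alpha> - \<beta>) * (\<Sum>m. gauss_term \<alpha> \<beta> \<gamma> m))"
    by (intro sums_mult summable_sums)
  have "summable (\<lambda>m. norm (gauss_term \<alpha> \<beta> (\<gamma> + 1) m))"
    using not_nonpos_Int_add_of_nat[OF assms(1), of 1] assms(2) by (intro gauss_term_abs_summable) auto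
  then have "(\<lambda>m. (\<gamma> - \<alpha>) * (\<gamma> - \<beta>) * gauss_term \<alpha> \<beta> (\<gamma> + 1) m) sums
       ((\<gamma> - \<alpha>) * (\<gamma> - \<beta>) * (\<Sum>m. gauss_term \<alpha> \<beta> (\<gamma> + 1) m))"
    by (intro sums_mult summable_sums) (rule summable_norm_cancel)
  ultimately show ?thesis
    using sums_diff[OF s1] sums_unique2 by fastforce
qed

lemma gauss_sum_shift:
  assumes "\<gamma> \<notin> \<int>\<^sub>\<le>\<^sub>0" "\<gamma> > \<alpha> + \<beta>"
  shows "pochhammer \<gamma> k * pochhammer (\<gamma> - \<alpha> - \<beta>) k * (\<Sum>m. gauss_term \<alpha> \<beta> \<gamma> m) =
           pochhammer (\<gamma> - \<alpha>) k * pochhammer (\<gamma> - \<beta>) k * (\<Sum>m. gauss_term \<alpha> \<beta> (\<gamma> + real k) m)"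
proof (induction k)
  case (Suc k)
  have "(\<gamma> + real k) * (\<gamma> - \<alpha> - \<beta> + real k) * (\<Sum>m. gauss_term \<alpha> \<beta> (\<gamma> + real k) m) =
     (\<gamma> - \<alpha> + real k) * (\<gamma> - \<beta> + real k) * (\<Sum>m. gauss_term \<alpha> \<beta> (\<gamma> + real (Suc k)) m)"
    using gauss_sum_contiguous[OF not_nonpos_Int_add_of_nat[OF assms(1), of k], of \<alpha> \<beta>] assms(2)
    by (simp add: algebra_simps)
  with Suc.IH show ?case
    unfolding pochhammer_Suc by algebra
qed simp

lemma gauss_sum_tendsto_1:
  assumes "\<gamma> \<notin> \<int>\<^sub>\<le>\<^sub>0" "\<gamma> > \<alpha> + \<beta>"
  shows "(\<lambda>k. \<Sum>m. gauss_term \<alpha> \<beta> (\<gamma> + real k) m) \<longlonglongrightarrow> 1"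
proof -
  obtain k0 :: nat where "- \<gamma> < real k0"
    using reals_Archimedean2 by blast
  then have k0: "\<gamma> + real k0 > 0"
    by simp
  define \<delta> where "\<delta> = \<gamma> + real k0"
  have \<delta>: "\<delta> > 0" "\<delta> > \<alpha> + \<beta>" "\<delta> \<notin> \<int>\<^sub>\<le>\<^sub>0"
    using k0 assms not_nonpos_Int_add_of_nat[OF assms(1), of k0] by (auto simp: \<delta>_def)
  define M where "M = (\<Sum>m. norm (gauss_term \<alpha> \<beta> \<delta> (Suc m)))"
  have sumM: "summable (\<lambda>m. norm (gauss_term \<alpha> \<beta> \<delta> (Suc m)))"
    using gauss_term_abs_summable[OF \<delta>(3,2)] by (subst summable_Suc_iff)
  \<comment> \<open>Raising the parameter from \<open>\<delta> > 0\<close> to \<open>\<delta> + k\<close> shrinks every term but the zeroth, which is 1,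
    at least by the factor \<open>\<delta> / (\<delta> + k)\<close>.\<close>
  have bound: "norm ((\<Sum>m. gauss_term \<alpha> \<beta> (\<delta> + real k) m) - 1) \<le> \<delta> / (\<delta> + real k) * M" for k
  proof -
    have nz: "\<delta> + real k \<notin> \<int>\<^sub>\<le>\<^sub>0" "\<delta> + real k > \<alpha> + \<beta>"
      using \<delta> not_nonpos_Int_add_of_nat[OF \<delta>(3), of k] by auto
    have s: "summable (\<lambda>m. norm (gauss_term \<alpha> \<beta> (\<delta> + real k) m))"
      using gauss_term_abs_summable[OF nz] .
    have le: "norm (gauss_term \<alpha> \<beta> (\<delta> + real k) (Suc m)) \<le>
        \<delta> / (\<delta> + real k) * norm (gauss_term \<alpha> \<beta> \<delta> (Suc m))" for m
    proof -
      have "0 < pochhammer (\<delta> + 1) m"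
        using \<delta>(1) by (intro pochhammer_pos) auto
      moreover have "pochhammer (\<delta> + 1) m \<le> pochhammer (\<delta> + real k + 1) m"
        using \<delta>(1) unfolding pochhammer_prod by (intro prod_mono) auto
      ultimately have "1 / pochhammer (\<delta> + real k + 1) m \<le> 1 / pochhammer (\<delta> + 1) m"
        by (intro divide_left_mono mult_pos_pos) auto
      then have "1 / (\<delta> + real k) * (1 / pochhammer (\<delta> + real k + 1) m) \<le>
          1 / (\<delta> + real k) * (1 / pochhammer (\<delta> + 1) m)"
        using \<delta>(1) by (intro mult_left_mono) auto
      then have "1 / pochhammer (\<delta> + real k) (Suc m) \<le> \<delta> / (\<delta> + real k) * (1 / pochhammer \<delta> (Suc m))"
        using \<delta>(1) by (simp add: pochhammer_rec)
      moreover have "pochhammer (\<delta> + real k) (Suc m) > 0" "pochhammer \<delta> (Suc m) > 0"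
        using \<delta>(1) by (auto intro!: pochhammer_pos)
      ultimately have "\<bar>pochhammer \<alpha> (Suc m)\<bar> * \<bar>pochhammer \<beta> (Suc m)\<bar> / fact (Suc m) * (1 / pochhammer (\<delta> + real k) (Suc m))
          \<le> \<bar>pochhammer \<alpha> (Suc m)\<bar> * \<bar>pochhammer \<beta> (Suc m)\<bar> / fact (Suc m) * (\<delta> / (\<delta> + real k) * (1 / pochhammer \<delta> (Suc m)))"
        by (intro mult_left_mono) auto
      then show ?thesis
        using \<open>pochhammer (\<delta> + real k) (Suc m) > 0\<close> \<open>pochhammer \<delta> (Suc m) > 0\<close>
        by (simp add: gauss_term_def abs_mult mult_ac del: pochhammer_Suc fact_Suc)
    qed
    have "(\<Sum>m. gauss_term \<alpha> \<beta> (\<delta> + real k) m) - 1 = (\<Sum>m. gauss_term \<alpha> \<beta> (\<delta> + real k) (Suc m))"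
      using suminf_split_head[OF summable_norm_cancel[OF s]] by (simp add: gauss_term_def)
    also have "norm \<dots> \<le> (\<Sum>m. \<delta> / (\<delta> + real k) * norm (gauss_term \<alpha> \<beta> \<delta> (Suc m)))"
      using le by (intro norm_suminf_le summable_mult sumM)
    also have "\<dots> = \<delta> / (\<delta> + real k) * M"
      unfolding M_def by (rule suminf_mult[OF sumM])
    finally show ?thesis .
  qed
  have "(\<lambda>k. \<delta> / (\<delta> + real k) * M) \<longlonglongrightarrow> 0"
    by real_asymp
  then have "(\<lambda>k. (\<Sum>m. gauss_term \<alpha> \<beta> (\<delta> + real k) m) - 1) \<longlonglongrightarrow> 0"
    by (rule Lim_null_comparison[rotated]) (use bound in auto)
  then have "(\<lambda>k. \<Sum>m. gauss_term \<alpha> \<beta> (\<gamma> + real (k + k0)) m) \<longlonglongrightarrow> 1"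
    by (simp add: LIM_zero_iff \<delta>_def algebra_simps)
  then show ?thesis
    by (rule LIMSEQ_offset)
qed

text \<open>Gauss's summation theorem. Iterating the contiguous relation expresses the sum as a quotient of
  Pochhammer symbols times the sum for \<open>\<gamma> + k\<close>; for \<open>k \<rightarrow> \<infinity>\<close> the latter tends to 1, and the quotient
  to the quotient of Gamma values.\<close>

lemma gauss_sum:
  assumes "\<gamma> \<notin> \<int>\<^sub>\<le>\<^sub>0" "\<gamma> > \<alpha> + \<beta>"
  shows "(gauss_term \<alpha> \<beta> \<gamma> has_sum Gamma \<gamma> * Gamma (\<gamma> - \<alpha> - \<beta>) * rGamma (\<gamma> - \<alpha>) * rGamma (\<gamma> - \<beta>)) UNIV"
proof -
  define F where "F = (\<Sum>m. gauss_term \<alpha> \<beta> \<gamma> m)"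
  have nz: "\<gamma> - \<alpha> - \<beta> \<notin> \<int>\<^sub>\<le>\<^sub>0"
    using assms(2) by (auto elim!: nonpos_Ints_cases)
  \<comment> \<open>The exponential factors of the four \<^const>\<open>rGamma_series\<close> cancel because
    \<open>(\<gamma> - \<alpha>) + (\<gamma> - \<beta>) = \<gamma> + (\<gamma> - \<alpha> - \<beta>)\<close>.\<close>
  have "(rGamma_series (\<gamma> - \<alpha>) k * rGamma_series (\<gamma> - \<beta>) k) /
         (rGamma_series \<gamma> k * rGamma_series (\<gamma> - \<alpha> - \<beta>) k)
         * (\<Sum>m. gauss_term \<alpha> \<beta> (\<gamma> + real (Suc k)) m) = F" for k
  proof -
    define E where "E = (\<lambda>z. exp (z * ln (real k)))"
    have E: "E (\<gamma> - \<alpha>) * E (\<gamma> - \<beta>) = E \<gamma> * E (\<gamma> - \<alpha> - \<beta>)" "\<And>z. E z \<noteq> 0"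
      by (simp_all add: E_def exp_add[symmetric] algebra_simps)
    have poch: "pochhammer z (Suc k) = rGamma_series z k * (fact k * E z)" for z
      by (simp add: rGamma_series_def E_def)
    have nz': "rGamma_series \<gamma> k \<noteq> 0" "rGamma_series (\<gamma> - \<alpha> - \<beta>) k \<noteq> 0"
      using poch[of \<gamma>] poch[of "\<gamma> - \<alpha> - \<beta>"] pochhammer_nonzero_of_not_nonpos_Int[OF assms(1), of "Suc k"]
        pochhammer_nonzero_of_not_nonpos_Int[OF nz, of "Suc k"] by auto
    have "(fact k * fact k * (E \<gamma> * E (\<gamma> - \<alpha> - \<beta>))) *
            (rGamma_series \<gamma> k * rGamma_series (\<gamma> - \<alpha> - \<beta>) k * F) =
        (fact k * fact k * (E (\<gamma> - \<alpha>) * E (\<gamma> - \<beta>))) *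
            (rGamma_series (\<gamma> - \<alpha>) k * rGamma_series (\<gamma> - \<beta>) k *
              (\<Sum>m. gauss_term \<alpha> \<beta> (\<gamma> + real (Suc k)) m))"
      using gauss_sum_shift[OF assms, of "Suc k"] unfolding poch F_def by (simp add: mult_ac)
    then have "rGamma_series \<gamma> k * rGamma_series (\<gamma> - \<alpha> - \<beta>) k * F =
       rGamma_series (\<gamma> - \<alpha>) k * rGamma_series (\<gamma> - \<beta>) k *
              (\<Sum>m. gauss_term \<alpha> \<beta> (\<gamma> + real (Suc k)) m)"
      unfolding E(1) using E(2) by simp
    then show ?thesis
      using nz' by (simp add: field_simps)
  qed
  moreover have "(\<lambda>k. (rGamma_series (\<gamma> - \<alpha>) k * rGamma_series (\<gamma> - \<beta>) k) /
         (rGamma_series \<gamma> k * rGamma_series (\<gamma> - \<alpha> - \<beta>) k)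
         * (\<Sum>m. gauss_term \<alpha> \<beta> (\<gamma> + real (Suc k)) m)) \<longlonglongrightarrow>
       (rGamma (\<gamma> - \<alpha>) * rGamma (\<gamma> - \<beta>)) / (rGamma \<gamma> * rGamma (\<gamma> - \<alpha> - \<beta>)) * 1"
    using assms nz
    by (intro tendsto_intros LIMSEQ_Suc[OF gauss_sum_tendsto_1]) (auto simp: rGamma_eq_zero_iff)
  ultimately have "F = (rGamma (\<gamma> - \<alpha>) * rGamma (\<gamma> - \<beta>)) / (rGamma \<gamma> * rGamma (\<gamma> - \<alpha> - \<beta>))"
    by (simp add: tendsto_const_iff)
  then have F: "F = Gamma \<gamma> * Gamma (\<gamma> - \<alpha> - \<beta>) * rGamma (\<gamma> - \<alpha>) * rGamma (\<gamma> - \<beta>)"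
    by (simp add: Gamma_def field_simps)
  have s: "summable (\<lambda>m. norm (gauss_term \<alpha> \<beta> \<gamma> m))"
    using gauss_term_abs_summable[OF assms] .
  have "gauss_term \<alpha> \<beta> \<gamma> sums F"
    unfolding F_def using summable_norm_cancel[OF s] by (rule summable_sums)
  then show ?thesis
    unfolding F[symmetric] by (rule norm_summable_imp_has_sum[OF s])
qed

text \<open>The terminating case needs no condition on \<open>\<gamma> - \<alpha> - \<beta>\<close>.\<close>

lemma chu_vandermonde:
  assumes "\<gamma> \<notin> \<int>\<^sub>\<le>\<^sub>0"
  shows "(gauss_term \<alpha> (- real p) \<gamma> has_sum pochhammer (\<gamma> - \<alpha>) p / pochhammer \<gamma> p) UNIV"
proof (rule has_sum_finite_neutralI[of "{0..p}"])
  have "\<forall>i\<in>{0..<p}. \<gamma> \<noteq> - of_nat i"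
    using assms by auto
  from Vandermonde_pochhammer[OF this, of \<alpha>]
  show "pochhammer (\<gamma> - \<alpha>) p / pochhammer \<gamma> p = sum (gauss_term \<alpha> (- real p) \<gamma>) {0..p}"
    by (simp add: gauss_term_def)
qed (auto simp: gauss_term_def pochhammer_of_nat_eq_0_iff)

text \<open>The next three lemmas sum a shifted series, as it occurs when the last of the indices of the
  multiple series varies. The point is that the factors with \<open>a - \<alpha>\<close> and \<open>a - \<beta>\<close> collapse into
  one with the merged parameter \<open>\<alpha> + \<beta>\<close>, and that the constant \<open>K\<close> does not depend on the shifts \<open>C\<close>,
  \<open>D\<close>, \<open>N\<close>. The equation for \<open>K\<close> is stated with \<^const>\<open>rGamma\<close>, so that it makes sense when
  \<open>a - \<alpha> - \<beta>\<close> is a pole of \<open>\<Gamma>\<close>, which may happen in the terminating case.\<close>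

lemma gauss_reduction_terminating:
  fixes a \<alpha> :: real and p :: nat
  assumes a: "a \<notin> \<int>\<^sub>\<le>\<^sub>0"
  defines "\<beta> \<equiv> - real p" and "K \<equiv> pochhammer (a - \<alpha>) p / pochhammer a p"
  shows "K * rGamma (a - \<alpha> - \<beta>) = Gamma a * rGamma (a - \<alpha>) * rGamma (a - \<beta>)"
    and "C + D \<le> N \<Longrightarrow>
      ((\<lambda>q. pochhammer \<alpha> (C + q) * pochhammer \<beta> (D + q) / (fact q * pochhammer a (N + q))
              * (pochhammer (a - \<alpha>) (N - C) * pochhammer (a - \<beta>) (N - D)))
         has_sum K * (pochhammer \<alpha> C * pochhammer \<beta> D * pochhammer (a - \<alpha> - \<beta>) (N - C - D))) UNIV"
proof -
  have "rGamma (a - \<alpha>) = pochhammer (a - \<alpha>) p * rGamma (a - \<alpha> + real p)"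
    "rGamma a = pochhammer a p * rGamma (a + real p)"
    by (rule pochhammer_rGamma)+
  moreover have "Gamma a * rGamma a = 1"
    using a by (simp add: Gamma_def rGamma_eq_zero_iff)
  ultimately show "K * rGamma (a - \<alpha> - \<beta>) = Gamma a * rGamma (a - \<alpha>) * rGamma (a - \<beta>)"
    using pochhammer_nonzero_of_not_nonpos_Int[OF a, of p] unfolding K_def \<beta>_def by (simp add: field_simps)
next
  assume N: "C + D \<le> N"
  show "((\<lambda>q. pochhammer \<alpha> (C + q) * pochhammer \<beta> (D + q) / (fact q * pochhammer a (N + q))
              * (pochhammer (a - \<alpha>) (N - C) * pochhammer (a - \<beta>) (N - D)))
         has_sum K * (pochhammer \<alpha> C * pochhammer \<beta> D * pochhammer (a - \<alpha> - \<beta>) (N - C - D))) UNIV"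
  proof (cases "D \<le> p")
    case False
    then have "pochhammer \<beta> (D + q) = 0" for q
      by (simp add: \<beta>_def pochhammer_of_nat_eq_0_iff)
    from this this[of 0] show ?thesis
      by simp
  next
    case True
    define r where "r = p - D"
    define W where "W = pochhammer \<alpha> C * pochhammer \<beta> D / pochhammer a N
                         * (pochhammer (a - \<alpha>) (N - C) * pochhammer (a - \<beta>) (N - D))"
    have \<beta>: "\<beta> + real D = - real r"
      using True by (simp add: \<beta>_def r_def)
    have "W * gauss_term (\<alpha> + real C) (- real r) (a + real N) q =
        pochhammer \<alpha> (C + q) * pochhammer \<beta> (D + q) / (fact q * pochhammer a (N + q))
              * (pochhammer (a - \<alpha>) (N - C) * pochhammer (a - \<beta>) (N - D))" for q
      by (simp add: W_def gauss_term_def pochhammer_product' \<beta> mult_ac)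
    moreover have "((\<lambda>q. W * gauss_term (\<alpha> + real C) (- real r) (a + real N) q) has_sum
        W * (pochhammer (a + real N - (\<alpha> + real C)) r / pochhammer (a + real N) r)) UNIV"
      by (intro has_sum_cmult_right chu_vandermonde not_nonpos_Int_add_of_nat a)
    moreover have "W * (pochhammer (a + real N - (\<alpha> + real C)) r / pochhammer (a + real N) r) =
        K * (pochhammer \<alpha> C * pochhammer \<beta> D * pochhammer (a - \<alpha> - \<beta>) (N - C - D))"
    proof -
      have "N + r = p + (N - D)" "N - C + r = p + (N - C - D)"
        using N True by (auto simp: r_def)
      then have e: "pochhammer a N * pochhammer (a + real N) r = pochhammer a p * pochhammer (a - \<beta>) (N - D)"
        "pochhammer (a - \<alpha>) (N - C) * pochhammer (a - \<alpha> + real (N - C)) r =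
         pochhammer (a - \<alpha>) p * pochhammer (a - \<alpha> - \<beta>) (N - C - D)"
        using pochhammer_product'[of a N r] pochhammer_product'[of a p "N - D"]
          pochhammer_product'[of "a - \<alpha>" "N - C" r] pochhammer_product'[of "a - \<alpha>" p "N - C - D"]
        by (simp_all add: \<beta>_def)
      have nz: "pochhammer a N \<noteq> 0" "pochhammer (a + real N) r \<noteq> 0" "pochhammer a p \<noteq> 0"
        "pochhammer (a - \<beta>) (N - D) \<noteq> 0"
        using a not_nonpos_Int_add_of_nat[OF a] by (auto intro!: pochhammer_nonzero_of_not_nonpos_Int simp: \<beta>_def)
      have eq: "a + real N - (\<alpha> + real C) = a - \<alpha> + real (N - C)"
        using N by simp
      have "W * (pochhammer (a + real N - (\<alpha> + real C)) r / pochhammer (a + real N) r) =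
          pochhammer \<alpha> C * pochhammer \<beta> D * pochhammer (a - \<beta>) (N - D) *
           (pochhammer (a - \<alpha>) (N - C) * pochhammer (a - \<alpha> + real (N - C)) r)
            / (pochhammer a N * pochhammer (a + real N) r)"
        unfolding eq W_def by (simp only: times_divide_eq_left times_divide_eq_right divide_divide_eq_left mult_ac)
      also have "\<dots> = K * (pochhammer \<alpha> C * pochhammer \<beta> D * pochhammer (a - \<alpha> - \<beta>) (N - C - D))"
        unfolding e K_def using nz by simp
      finally show ?thesis .
    qed
    ultimately show ?thesis
      by (simp only:)
  qed
qed

lemma gauss_reduction_convergent:
  fixes a \<alpha> \<beta> :: real
  assumes a: "a \<notin> \<int>\<^sub>\<le>\<^sub>0" and less: "\<alpha> + \<beta> < a"
  defines "K \<equiv> Gamma a * Gamma (a - \<alpha> - \<beta>) * rGamma (a - \<alpha>) * rGamma (a - \<beta>)"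
  shows "K * rGamma (a - \<alpha> - \<beta>) = Gamma a * rGamma (a - \<alpha>) * rGamma (a - \<beta>)"
    and "C + D \<le> N \<Longrightarrow>
      ((\<lambda>q. pochhammer \<alpha> (C + q) * pochhammer \<beta> (D + q) / (fact q * pochhammer a (N + q))
              * (pochhammer (a - \<alpha>) (N - C) * pochhammer (a - \<beta>) (N - D)))
         has_sum K * (pochhammer \<alpha> C * pochhammer \<beta> D * pochhammer (a - \<alpha> - \<beta>) (N - C - D))) UNIV"
proof -
  have nn: "a - \<alpha> - \<beta> \<notin> \<int>\<^sub>\<le>\<^sub>0"
    using less by (auto elim!: nonpos_Ints_cases)
  then have "Gamma (a - \<alpha> - \<beta>) * rGamma (a - \<alpha> - \<beta>) = 1"
    by (simp add: Gamma_def rGamma_eq_zero_iff)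
  then show "K * rGamma (a - \<alpha> - \<beta>) = Gamma a * rGamma (a - \<alpha>) * rGamma (a - \<beta>)"
    unfolding K_def by algebra
  assume N: "C + D \<le> N"
  define W where "W = pochhammer \<alpha> C * pochhammer \<beta> D / pochhammer a N
                       * (pochhammer (a - \<alpha>) (N - C) * pochhammer (a - \<beta>) (N - D))"
  define V where "V = Gamma (a + real N) * Gamma (a + real N - (\<alpha> + real C) - (\<beta> + real D))
           * rGamma (a + real N - (\<alpha> + real C)) * rGamma (a + real N - (\<beta> + real D))"
  have "W * gauss_term (\<alpha> + real C) (\<beta> + real D) (a + real N) q =
      pochhammer \<alpha> (C + q) * pochhammer \<beta> (D + q) / (fact q * pochhammer a (N + q))
            * (pochhammer (a - \<alpha>) (N - C) * pochhammer (a - \<beta>) (N - D))" for q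
    by (simp add: W_def gauss_term_def pochhammer_product' mult_ac)
  moreover have "((\<lambda>q. W * gauss_term (\<alpha> + real C) (\<beta> + real D) (a + real N) q) has_sum W * V) UNIV"
    unfolding V_def using less N by (intro has_sum_cmult_right gauss_sum not_nonpos_Int_add_of_nat a) linarith
  moreover have "W * V =
      K * (pochhammer \<alpha> C * pochhammer \<beta> D * pochhammer (a - \<alpha> - \<beta>) (N - C - D))"
  proof -
    have eqs: "a + real N - (\<alpha> + real C) - (\<beta> + real D) = a - \<alpha> - \<beta> + real (N - C - D)"
         "a + real N - (\<alpha> + real C) = a - \<alpha> + real (N - C)"
         "a + real N - (\<beta> + real D) = a - \<beta> + real (N - D)"
      using N by simp_all
    have V: "V = Gamma (a + real N) * Gamma (a - \<alpha> - \<beta> + real (N - C - D))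
           * rGamma (a - \<alpha> + real (N - C)) * rGamma (a - \<beta> + real (N - D))"
      unfolding V_def eqs(1) unfolding eqs(2,3) ..
    have "Gamma a \<noteq> 0" "Gamma (a - \<alpha> - \<beta>) \<noteq> 0"
      using a nn by (simp_all add: Gamma_eq_zero_iff)
    then have G: "Gamma (a + real N) = pochhammer a N * Gamma a"
      "Gamma (a - \<alpha> - \<beta> + real (N - C - D)) = pochhammer (a - \<alpha> - \<beta>) (N - C - D) * Gamma (a - \<alpha> - \<beta>)"
      by (simp_all add: pochhammer_Gamma[OF a] pochhammer_Gamma[OF nn])
    have R: "rGamma (a - \<alpha>) = pochhammer (a - \<alpha>) (N - C) * rGamma (a - \<alpha> + real (N - C))"
      "rGamma (a - \<beta>) = pochhammer (a - \<beta>) (N - D) * rGamma (a - \<beta> + real (N - D))"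
      by (rule pochhammer_rGamma)+
    show ?thesis
      using pochhammer_nonzero_of_not_nonpos_Int[OF a, of N] unfolding V W_def K_def G R by simp
  qed
  ultimately show "((\<lambda>q. pochhammer \<alpha> (C + q) * pochhammer \<beta> (D + q) / (fact q * pochhammer a (N + q))
              * (pochhammer (a - \<alpha>) (N - C) * pochhammer (a - \<beta>) (N - D)))
         has_sum K * (pochhammer \<alpha> C * pochhammer \<beta> D * pochhammer (a - \<alpha> - \<beta>) (N - C - D))) UNIV"
    by (simp only:)
qed

lemma gauss_reduction:
  fixes a \<alpha> \<beta> :: real
  assumes a: "a \<notin> \<int>\<^sub>\<le>\<^sub>0" and conv: "\<alpha> \<in> \<int>\<^sub>\<le>\<^sub>0 \<or> \<beta> \<in> \<int>\<^sub>\<le>\<^sub>0 \<or> \<alpha> + \<beta> < a"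
  obtains K where
    "K * rGamma (a - \<alpha> - \<beta>) = Gamma a * rGamma (a - \<alpha>) * rGamma (a - \<beta>)"
    "\<And>C D N. C + D \<le> N \<Longrightarrow>
      ((\<lambda>q. pochhammer \<alpha> (C + q) * pochhammer \<beta> (D + q) / (fact q * pochhammer a (N + q))
              * (pochhammer (a - \<alpha>) (N - C) * pochhammer (a - \<beta>) (N - D)))
         has_sum K * (pochhammer \<alpha> C * pochhammer \<beta> D * pochhammer (a - \<alpha> - \<beta>) (N - C - D))) UNIV"
proof -
  consider p where "\<beta> = - real p" | p where "\<alpha> = - real p" | "\<alpha> + \<beta> < a"
    using conv by (auto elim!: nonpos_Ints_cases')
  then show ?thesis
  proof cases
    case (1 p)
    show ?thesis
      by (rule that[OF gauss_reduction_terminating[OF a, where \<alpha> = \<alpha> and p = p, folded 1]])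
  next
    case (2 p)
    note red = gauss_reduction_terminating[OF a, where \<alpha> = \<beta> and p = p, folded 2]
    have swap: "a - \<beta> - \<alpha> = a - \<alpha> - \<beta>"
      by simp
    show ?thesis
    proof (rule that)
      show "pochhammer (a - \<beta>) p / pochhammer a p * rGamma (a - \<alpha> - \<beta>) =
          Gamma a * rGamma (a - \<alpha>) * rGamma (a - \<beta>)"
        using red(1) unfolding swap by (simp only: mult_ac)
    next
      fix C D N :: nat
      assume "C + D \<le> N"
      then have "D + C \<le> N" "N - D - C = N - C - D"
        by simp_all
      then show "((\<lambda>q. pochhammer \<alpha> (C + q) * pochhammer \<beta> (D + q) / (fact q * pochhammer a (N + q))
              * (pochhammer (a - \<alpha>) (N - C) * pochhammer (a - \<beta>) (N - D)))
         has_sum pochhammer (a - \<beta>) p / pochhammer a p *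
           (pochhammer \<alpha> C * pochhammer \<beta> D * pochhammer (a - \<alpha> - \<beta>) (N - C - D))) UNIV"
        using red(2)[of D C N] unfolding swap by (simp only: mult_ac)
    qed
  next
    case 3
    show ?thesis
      using that[OF gauss_reduction_convergent[OF a 3]] .
  qed
qed

section \<open>Splitting the last column of a family\<close>

lemma pochhammer_add_over_fact:
  fixes x y :: real
  shows "(\<Sum>k = 0..n. pochhammer x k * pochhammer y (n - k) / (fact k * fact (n - k))) =
           pochhammer (x + y) n / fact n"
  unfolding pochhammer_binomial_sum sum_divide_distrib atMost_atLeast0
  by (intro sum.cong refl) (simp add: binomial_fact)

text \<open>The Vandermonde identity for several indices that are split simultaneously. If \<open>t\<close> is
  the first part of \<open>M j\<close> for one index \<open>j\<close>, then \<open>(x)\<^sub>t\<^sub>+\<^sub>S = (x)\<^sub>t (x + t)\<^sub>S\<close> and the induction hypothesis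
  applies to the parameters \<open>x + t\<close> and \<open>y + M j - t\<close>; their sum does not depend on \<open>t\<close>.\<close>

lemma sum_splits_pochhammer:
  fixes x y :: real and M :: "'a \<Rightarrow> nat"
  assumes "finite I"
  shows "(\<Sum>s\<in>Pi\<^sub>E I (\<lambda>i. {0..M i}).
            pochhammer x (\<Sum>i\<in>I. s i) * pochhammer y (\<Sum>i\<in>I. M i - s i)
              / (\<Prod>i\<in>I. fact (s i) * fact (M i - s i))) =
         pochhammer (x + y) (\<Sum>i\<in>I. M i) / (\<Prod>i\<in>I. fact (M i))"
  using assms
proof (induction I arbitrary: x y rule: finite_induct)
  case (insert j I)
  have upd: "(\<Sum>i\<in>I. (s(j := t)) i) = (\<Sum>i\<in>I. s i)" "(\<Sum>i\<in>I. M i - (s(j := t)) i) = (\<Sum>i\<in>I. M i - s i)"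
     "(\<Prod>i\<in>I. fact ((s(j := t)) i) * fact (M i - (s(j := t)) i)) = (\<Prod>i\<in>I. fact (s i) * fact (M i - s i) :: real)"
    for s t
    using insert.hyps(2) by (auto intro!: sum.cong prod.cong)
  have "(\<Sum>s\<in>Pi\<^sub>E (insert j I) (\<lambda>i. {0..M i}).
            pochhammer x (\<Sum>i\<in>insert j I. s i) * pochhammer y (\<Sum>i\<in>insert j I. M i - s i)
              / (\<Prod>i\<in>insert j I. fact (s i) * fact (M i - s i))) =
     (\<Sum>(t, s)\<in>{0..M j} \<times> Pi\<^sub>E I (\<lambda>i. {0..M i}).
            pochhammer x (t + (\<Sum>i\<in>I. s i)) * pochhammer y (M j - t + (\<Sum>i\<in>I. M i - s i))
              / ((fact t * fact (M j - t)) * (\<Prod>i\<in>I. fact (s i) * fact (M i - s i))))"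
    unfolding PiE_insert_eq
    by (subst sum.reindex[OF inj_combinator[OF insert.hyps(2)]])
       (simp add: case_prod_unfold insert.hyps upd del: fun_upd_apply, simp)
  also have "\<dots> = (\<Sum>t = 0..M j. \<Sum>s\<in>Pi\<^sub>E I (\<lambda>i. {0..M i}).
       (pochhammer x t * pochhammer y (M j - t) / (fact t * fact (M j - t))) *
       (pochhammer (x + real t) (\<Sum>i\<in>I. s i) * pochhammer (y + real (M j - t)) (\<Sum>i\<in>I. M i - s i)
              / (\<Prod>i\<in>I. fact (s i) * fact (M i - s i))))"
    by (simp add: sum.cartesian_product pochhammer_product' mult_ac del: of_nat_diff)
  also have "\<dots> = (\<Sum>t = 0..M j.
       (pochhammer x t * pochhammer y (M j - t) / (fact t * fact (M j - t))) *
       (pochhammer (x + y + real (M j)) (\<Sum>i\<in>I. M i) / (\<Prod>i\<in>I. fact (M i))))"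
  proof (intro sum.cong refl)
    fix t assume "t \<in> {0..M j}"
    then have "x + real t + (y + real (M j - t)) = x + y + real (M j)"
      by simp
    then show "(\<Sum>s\<in>Pi\<^sub>E I (\<lambda>i. {0..M i}).
       (pochhammer x t * pochhammer y (M j - t) / (fact t * fact (M j - t))) *
       (pochhammer (x + real t) (\<Sum>i\<in>I. s i) * pochhammer (y + real (M j - t)) (\<Sum>i\<in>I. M i - s i)
              / (\<Prod>i\<in>I. fact (s i) * fact (M i - s i)))) =
       (pochhammer x t * pochhammer y (M j - t) / (fact t * fact (M j - t))) *
       (pochhammer (x + y + real (M j)) (\<Sum>i\<in>I. M i) / (\<Prod>i\<in>I. fact (M i)))"
      unfolding sum_distrib_left[symmetric] insert.IH by (simp only:)
  qed
  also have "\<dots> = pochhammer (x + y) (M j) / fact (M j) *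
       (pochhammer (x + y + real (M j)) (\<Sum>i\<in>I. M i) / (\<Prod>i\<in>I. fact (M i)))"
    unfolding sum_distrib_right[symmetric] pochhammer_add_over_fact ..
  also have "\<dots> = pochhammer (x + y) (\<Sum>i\<in>insert j I. M i) / (\<Prod>i\<in>insert j I. fact (M i))"
    using insert.hyps by (simp add: pochhammer_product')
  finally show ?case .
qed simp

lemma index_pairs_Suc: "index_pairs (Suc n) = index_pairs n \<union> (\<lambda>i. (i, Suc n)) ` {2..Suc n}"
  by (auto simp: index_pairs_def)

lemma finite_index_pairs: "finite (index_pairs n)"
  by (rule finite_subset[of _ "{..n} \<times> {..n}"]) (auto simp: index_pairs_def)

lemma prod_index_pairs_Suc:
  "(\<Prod>p\<in>index_pairs (Suc n). f p) = (\<Prod>p\<in>index_pairs n. f p) * (\<Prod>i = 2..Suc n. f (i, Suc n))"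
  for f :: "nat \<times> nat \<Rightarrow> real"
proof -
  have "(\<Prod>p\<in>(\<lambda>i. (i, Suc n)) ` {2..Suc n}. f p) = (\<Prod>i = 2..Suc n. f (i, Suc n))"
    by (subst prod.reindex) (auto simp: inj_on_def)
  then show ?thesis
    unfolding index_pairs_Suc
    by (subst prod.union_disjoint) (auto simp: finite_index_pairs, auto simp: index_pairs_def)
qed

text \<open>The ways to write each entry of column \<open>n\<close> as a sum of two natural numbers; a split is given by
  the first summands.\<close>

definition splits :: "nat \<Rightarrow> (nat \<times> nat \<Rightarrow> nat) \<Rightarrow> (nat \<Rightarrow> nat) set" where
  "splits n m = Pi\<^sub>E {2..n} (\<lambda>i. {0..m (i, n)})"

text \<open>The family for \<open>n + 1\<close> that arises from a family \<open>m\<close> for \<open>n\<close> by distributing column \<open>n\<close> over the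
  columns \<open>n\<close> and \<open>n + 1\<close> according to the split \<open>s\<close>, with the new corner entry \<open>q\<close> at
  \<open>(n + 1, n + 1)\<close>.\<close>

definition split_column :: "nat \<Rightarrow> (nat \<times> nat \<Rightarrow> nat) \<Rightarrow> (nat \<Rightarrow> nat) \<Rightarrow> nat \<Rightarrow> nat \<times> nat \<Rightarrow> nat" where
  "split_column n m s q = restrict (\<lambda>(i, j). if j < n then m (i, j) else if j = n then s i
      else if i \<le> n then m (i, n) - s i else q) (index_pairs (Suc n))"

lemma split_column_simps:
  "j < n \<Longrightarrow> 2 \<le> i \<Longrightarrow> i \<le> j \<Longrightarrow> split_column n m s q (i, j) = m (i, j)"
  "2 \<le> i \<Longrightarrow> i \<le> n \<Longrightarrow> split_column n m s q (i, n) = s i"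
  "2 \<le> i \<Longrightarrow> i \<le> n \<Longrightarrow> split_column n m s q (i, Suc n) = m (i, n) - s i"
  "1 \<le> n \<Longrightarrow> split_column n m s q (Suc n, Suc n) = q"
  by (auto simp: split_column_def index_pairs_def)

lemma bij_betw_split_column:
  assumes "n \<ge> 1"
  shows "bij_betw (\<lambda>((m, s), q). split_column n m s q)
           (Sigma (families n) (splits n) \<times> UNIV) (families (Suc n))"
proof (rule bij_betwI[where g = "\<lambda>m. ((restrict (\<lambda>(i, j). if j < n then m (i, j)
             else m (i, n) + m (i, Suc n)) (index_pairs n), restrict (\<lambda>i. m (i, n)) {2..n}), m (Suc n, Suc n))"],
       goal_cases)
  case 1
  then show ?case
    by (auto simp: families_def split_column_def)
next
  case 2
  then show ?case
    by (auto simp: families_def splits_def index_pairs_def)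
next
  case (3 x)
  obtain m s q where x: "x = ((m, s), q)"
    by (metis surj_pair)
  have m: "m \<in> extensional (index_pairs n)" and s: "s \<in> extensional {2..n}"
    and le: "\<And>i. i \<in> {2..n} \<Longrightarrow> s i \<le> m (i, n)"
    using 3 by (auto simp: x families_def splits_def PiE_def)
  have "restrict (\<lambda>(i, j). if j < n then split_column n m s q (i, j)
             else split_column n m s q (i, n) + split_column n m s q (i, Suc n)) (index_pairs n) = m"
    using le by (intro extensionalityI[OF restrict_extensional m])
      (auto simp: index_pairs_def split_column_simps)
  moreover have "restrict (\<lambda>i. split_column n m s q (i, n)) {2..n} = s"
    by (intro extensionalityI[OF restrict_extensional s]) (auto simp: split_column_simps)
  ultimately show ?case
    unfolding x prod.case by (simp add: split_column_simps(4)[OF assms])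
next
  case (4 m)
  then have m: "m \<in> extensional (index_pairs (Suc n))"
    by (auto simp: families_def PiE_def)
  show ?case
    unfolding prod.case split_column_def
    by (intro extensionalityI[OF restrict_extensional m])
       (auto simp: index_pairs_def le_Suc_eq not_less)
qed

context
  fixes n :: nat and m :: "nat \<times> nat \<Rightarrow> nat" and s :: "nat \<Rightarrow> nat" and q :: nat
  assumes n: "n \<ge> 1" and s: "s \<in> splits n m"
begin

lemma row_split_column:
  assumes "2 \<le> i" "i \<le> n"
  shows "(\<Sum>j = i..Suc n. split_column n m s q (i, j)) = (\<Sum>j = i..n. m (i, j))"
proof -
  obtain l where l: "n = Suc l"
    using n by (cases n) auto
  have "s i \<le> m (i, n)"
    using s assms by (auto simp: splits_def PiE_def Pi_def)
  moreover have "(\<Sum>j = i..l. split_column n m s q (i, j)) = (\<Sum>j = i..l. m (i, j))"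
    using assms by (intro sum.cong) (auto simp: split_column_simps l)
  ultimately show ?thesis
    using assms by (simp add: split_column_simps) (simp add: l split_column_simps[where n = "Suc l"])
qed

lemma A_split_column_less:
  assumes "k < n"
  shows "A (split_column n m s q) k (Suc n) = A m k n"
  unfolding A_def using assms by (intro sum.cong[OF refl] row_split_column) auto

lemma A_split_column:
  "A (split_column n m s q) n (Suc n) = A m n n + q"
  "A (split_column n m s q) (Suc n) (Suc n) = A m n n + q"
proof -
  have "(\<Sum>i = 2..n. \<Sum>j = i..Suc n. split_column n m s q (i, j)) = (\<Sum>i = 2..n. \<Sum>j = i..n. m (i, j))"
    by (intro sum.cong[OF refl] row_split_column) auto
  then show "A (split_column n m s q) n (Suc n) = A m n n + q"
    using n by (simp add: A_def split_column_simps)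
  then show "A (split_column n m s q) (Suc n) (Suc n) = A m n n + q"
    using n by (simp add: A_def)
qed

lemma B_split_column_less:
  assumes "1 \<le> k" "k < n"
  shows "B (split_column n m s q) k (Suc n) = B m k n"
proof -
  have "(\<Sum>i = 2..k. split_column n m s q (i, k)) = (\<Sum>i = 2..k. m (i, k))"
    using assms by (intro sum.cong) (auto simp: split_column_simps)
  then show ?thesis
    unfolding B_def using assms row_split_column[of "k + 1"] by simp
qed

lemma B_split_column:
  "B (split_column n m s q) n (Suc n) = (\<Sum>i = 2..n. s i) + q"
  "B (split_column n m s q) (Suc n) (Suc n) = (\<Sum>i = 2..n. m (i, n) - s i) + q"
  using n by (simp_all add: B_def split_column_simps)

lemma prod_fact_split_column:
  "(\<Prod>p\<in>index_pairs (Suc n). fact (split_column n m s q p)) =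
     (\<Prod>p\<in>index_pairs (n - 1). fact (m p)) * (\<Prod>i = 2..n. fact (s i) * fact (m (i, n) - s i)) * (fact q :: real)"
proof -
  obtain l where l: "n = Suc l"
    using n by (cases n) auto
  have "(\<Prod>p\<in>index_pairs l. fact (split_column n m s q p)) = (\<Prod>p\<in>index_pairs l. fact (m p) :: real)"
    by (intro prod.cong) (auto simp: index_pairs_def l split_column_simps)
  then show ?thesis
    by (simp add: l prod_index_pairs_Suc prod.distrib split_column_simps)
qed

lemma split_sums:
  "(\<Sum>i = 2..n. s i) + (\<Sum>i = 2..n. m (i, n) - s i) = B m n n"
proof -
  have "s i \<le> m (i, n)" if "i \<in> {2..n}" for i
    using s that by (auto simp: splits_def PiE_def Pi_def)
  then show ?thesis
    by (simp add: B_def flip: sum.distrib)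
qed

end

text \<open>The part of \<^const>\<open>series_term\<close> that involves neither \<open>b\<^sub>n\<close> nor column \<open>n\<close> of the factorials. It is
  unchanged when column \<open>n\<close> is split.\<close>

definition common_factor :: "real \<Rightarrow> (nat \<Rightarrow> real) \<Rightarrow> nat \<Rightarrow> (nat \<times> nat \<Rightarrow> nat) \<Rightarrow> real" where
  "common_factor a b n m =
     (\<Prod>k = 1..<n. pochhammer (b k) (B m k n) * pochhammer (a - b k) (A m k n - B m k n)
                    / pochhammer a (A m k n)) / (\<Prod>p\<in>index_pairs (n - 1). fact (m p))"

lemma series_term_eq_common_factor:
  assumes "a \<notin> \<int>\<^sub>\<le>\<^sub>0" "n \<ge> 1"
  shows "series_term a b n m = common_factor a b n m *
    (pochhammer (b n) (B m n n) * pochhammer (a - b n) (A m n n - B m n n) / (\<Prod>i = 2..n. fact (m (i, n))))"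
proof -
  obtain l where l: "n = Suc l"
    using assms by (cases n) auto
  show ?thesis
    using pochhammer_nonzero_of_not_nonpos_Int[OF assms(1), of "A m n n"]
    by (simp add: series_term_def common_factor_def l prod_index_pairs_Suc atLeastLessThanSuc_atLeastAtMost)
qed

lemma series_term_split_column:
  assumes a: "a \<notin> \<int>\<^sub>\<le>\<^sub>0" and n: "n \<ge> 1" and s: "s \<in> splits n m"
  defines "C \<equiv> \<Sum>i = 2..n. s i" and "D \<equiv> \<Sum>i = 2..n. m (i, n) - s i"
  shows "series_term a b (Suc n) (split_column n m s q) =
    common_factor a b n m / (\<Prod>i = 2..n. fact (s i) * fact (m (i, n) - s i)) *
      (pochhammer (b n) (C + q) * pochhammer (b (Suc n)) (D + q) / (fact q * pochhammer a (A m n n + q))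
       * (pochhammer (a - b n) (A m n n - C) * pochhammer (a - b (Suc n)) (A m n n - D)))"
proof -
  have prod: "(\<Prod>k = 1..Suc n. f k) = (\<Prod>k = 1..<n. f k) * f n * f (Suc n)" for f :: "nat \<Rightarrow> real"
    using n by (simp add: atLeastLessThanSuc_atLeastAtMost[symmetric] mult_ac)
  have "(\<Prod>k = 1..<n. pochhammer (b k) (B (split_column n m s q) k (Suc n)) *
           pochhammer (a - b k) (A (split_column n m s q) k (Suc n) - B (split_column n m s q) k (Suc n))
                    / pochhammer a (A (split_column n m s q) k (Suc n))) =
    (\<Prod>k = 1..<n. pochhammer (b k) (B m k n) * pochhammer (a - b k) (A m k n - B m k n)
                    / pochhammer a (A m k n))"
    by (intro prod.cong refl) (simp add: A_split_column_less[OF n s] B_split_column_less[OF n s])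
  then show ?thesis
    using pochhammer_nonzero_of_not_nonpos_Int[OF a, of "A m n n + q"]
    unfolding series_term_def prod A_split_column[OF n s] B_split_column[OF n s] C_def D_def
      prod_fact_split_column[OF n s] common_factor_def
    by (simp add: mult_ac)
qed

section \<open>Reduction of the multiple series to one parameter less\<close>

lemma common_factor_upd: "common_factor a (b(n := x)) n m = common_factor a b n m"
  unfolding common_factor_def by simp

lemma sum_merge_parameters:
  fixes b :: "nat \<Rightarrow> real"
  assumes "n \<ge> 1"
  shows "(\<Sum>k = 1..n. (b(n := b n + b (Suc n))) k) = (\<Sum>k = 1..Suc n. b k)"
proof -
  obtain l where l: "n = Suc l"
    using assms by (cases n) auto
  have "(\<Sum>k = 1..l. (b(n := b n + b (Suc n))) k) = (\<Sum>k = 1..l. b k)"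
    by (intro sum.cong) (auto simp: l)
  then show ?thesis
    by (simp add: l)
qed

text \<open>The series for \<open>n + 1\<close> parameters summed first over the corner entry and then over the splits of
  column \<open>n\<close> is, up to a constant, the series for the \<open>n\<close> parameters
  \<open>b\<^sub>1, \<dots>, b\<^sub>n\<^sub>-\<^sub>1, b\<^sub>n + b\<^sub>n\<^sub>+\<^sub>1\<close>.\<close>

lemma reduce_series_term:
  assumes a: "a \<notin> \<int>\<^sub>\<le>\<^sub>0" and n: "n \<ge> 1"
    and conv: "b n \<in> \<int>\<^sub>\<le>\<^sub>0 \<or> b (Suc n) \<in> \<int>\<^sub>\<le>\<^sub>0 \<or> b n + b (Suc n) < a"
  obtains K R where
    "K * rGamma (a - b n - b (Suc n)) = Gamma a * rGamma (a - b n) * rGamma (a - b (Suc n))"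
    "\<And>m s. s \<in> splits n m \<Longrightarrow>
       ((\<lambda>q. series_term a b (Suc n) (split_column n m s q)) has_sum R m s) UNIV"
    "\<And>m. (R m has_sum K * series_term a (b(n := b n + b (Suc n))) n m) (splits n m)"
proof -
  let ?\<alpha> = "b n" and ?\<beta> = "b (Suc n)"
  obtain K where K: "K * rGamma (a - ?\<alpha> - ?\<beta>) = Gamma a * rGamma (a - ?\<alpha>) * rGamma (a - ?\<beta>)"
    and red: "\<And>C D N. C + D \<le> N \<Longrightarrow>
      ((\<lambda>q. pochhammer ?\<alpha> (C + q) * pochhammer ?\<beta> (D + q) / (fact q * pochhammer a (N + q))
              * (pochhammer (a - ?\<alpha>) (N - C) * pochhammer (a - ?\<beta>) (N - D)))
         has_sum K * (pochhammer ?\<alpha> C * pochhammer ?\<beta> D * pochhammer (a - ?\<alpha> - ?\<beta>) (N - C - D))) UNIV"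
    using gauss_reduction[OF a conv] by blast
  define R where "R = (\<lambda>m s. common_factor a b n m / (\<Prod>i = 2..n. fact (s i) * fact (m (i, n) - s i)) *
      (K * (pochhammer ?\<alpha> (\<Sum>i = 2..n. s i) * pochhammer ?\<beta> (\<Sum>i = 2..n. m (i, n) - s i) *
        pochhammer (a - ?\<alpha> - ?\<beta>) (A m n n - (\<Sum>i = 2..n. s i) - (\<Sum>i = 2..n. m (i, n) - s i)))))"
  show ?thesis
  proof (rule that[OF K])
    fix m s assume s: "s \<in> splits n m"
    have "(\<Sum>i = 2..n. s i) + (\<Sum>i = 2..n. m (i, n) - s i) \<le> A m n n"
      using split_sums[OF n s] B_le_A[of n n m] n by simp
    from has_sum_cmult_right[OF red[OF this]]
    show "((\<lambda>q. series_term a b (Suc n) (split_column n m s q)) has_sum R m s) UNIV"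
      unfolding series_term_split_column[OF a n s] R_def .
  next
    fix m
    define Q where "Q = common_factor a b n m * K * pochhammer (a - ?\<alpha> - ?\<beta>) (A m n n - B m n n)"
    have fin: "finite (splits n m)"
      unfolding splits_def by (intro finite_PiE) auto
    have "(\<Sum>s\<in>splits n m. R m s) = (\<Sum>s\<in>splits n m. Q *
        (pochhammer ?\<alpha> (\<Sum>i = 2..n. s i) * pochhammer ?\<beta> (\<Sum>i = 2..n. m (i, n) - s i)
              / (\<Prod>i = 2..n. fact (s i) * fact (m (i, n) - s i))))"
    proof (intro sum.cong refl)
      fix s assume "s \<in> splits n m"
      then have "A m n n - (\<Sum>i = 2..n. s i) - (\<Sum>i = 2..n. m (i, n) - s i) = A m n n - B m n n"
        using split_sums[OF n] by (simp add: diff_diff_left)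
      then show "R m s = Q *
        (pochhammer ?\<alpha> (\<Sum>i = 2..n. s i) * pochhammer ?\<beta> (\<Sum>i = 2..n. m (i, n) - s i)
              / (\<Prod>i = 2..n. fact (s i) * fact (m (i, n) - s i)))"
        unfolding R_def Q_def by (simp add: mult_ac)
    qed
    also have "\<dots> = Q * (pochhammer (?\<alpha> + ?\<beta>) (\<Sum>i = 2..n. m (i, n)) / (\<Prod>i = 2..n. fact (m (i, n))))"
      unfolding splits_def sum_distrib_left[symmetric] by (simp only: sum_splits_pochhammer finite_atLeastAtMost)
    also have "\<dots> = K * series_term a (b(n := ?\<alpha> + ?\<beta>)) n m"
      unfolding series_term_eq_common_factor[OF a n] common_factor_upd Q_def
      by (simp add: B_def diff_diff_eq mult_ac)
    finally show "(R m has_sum K * series_term a (b(n := ?\<alpha> + ?\<beta>)) n m) (splits n m)"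
      using fin by (simp add: has_sum_finite_iff)
  qed
qed

lemma series_term_summable_iff_split:
  assumes "n \<ge> 1"
  shows "(\<lambda>((m, s), q). series_term a b (Suc n) (split_column n m s q)) summable_on
           Sigma (families n) (splits n) \<times> UNIV \<longleftrightarrow> series_term a b (Suc n) summable_on families (Suc n)"
  using summable_on_reindex_bij_betw[OF bij_betw_split_column[OF assms], of "series_term a b (Suc n)"]
  by (simp add: case_prod_unfold)

text \<open>Absolute convergence of the multiple series forces that of the subseries in which only the corner
  entry is non-zero. This is Gauss's series with the parameters \<open>b\<^sub>n\<close>, \<open>b\<^sub>n\<^sub>+\<^sub>1\<close>, \<open>a\<close>, hence either
  terminates or satisfies Gauss's condition.\<close>

lemma convergence_condition:
  assumes a: "a \<notin> \<int>\<^sub>\<le>\<^sub>0" and n: "n \<ge> 1"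
    and summable: "series_term a b (Suc n) summable_on families (Suc n)"
  shows "b n \<in> \<int>\<^sub>\<le>\<^sub>0 \<or> b (Suc n) \<in> \<int>\<^sub>\<le>\<^sub>0 \<or> b n + b (Suc n) < a"
proof -
  define m where "m = (\<lambda>p\<in>index_pairs n. 0 :: nat)"
  define s where "s = (\<lambda>i\<in>{2..n}. 0 :: nat)"
  have m: "m \<in> families n"
    by (auto simp: m_def families_def)
  have m_0: "m (i, j) = 0" if "2 \<le> i" "i \<le> j" "j \<le> n" for i j
    using that by (simp add: m_def index_pairs_def)
  have s: "s \<in> splits n m"
    using n by (auto simp: s_def splits_def m_0)
  have s_0: "(\<Sum>i = 2..n. s i) = 0" "(\<Sum>i = 2..n. m (i, n) - s i) = 0"
    by (simp_all add: s_def m_0)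
  have A_0: "A m k n = 0" if "k \<le> n" for k
    using that by (auto simp: A_def m_0)
  have B_0: "B m k n = 0" if "1 \<le> k" "k \<le> n" for k
    using B_le_A[OF that, of m] A_0[OF that(2)] by simp
  have "common_factor a b n m = 1 / (\<Prod>p\<in>index_pairs (n - 1). fact (m p))"
    by (simp add: common_factor_def A_0 B_0)
  also have "\<dots> = 1"
    by (subst prod.neutral) (auto simp: index_pairs_def m_0)
  finally have common: "common_factor a b n m = 1" .
  have prod: "(\<Prod>i = 2..n. fact (s i) * fact (m (i, n) - s i)) = (1 :: real)"
    by (rule prod.neutral) (simp add: s_def m_0)
  have "series_term a b (Suc n) (split_column n m s q) = gauss_term (b n) (b (Suc n)) a q" for q
    unfolding series_term_split_column[OF a n s] s_0 A_0[OF order.refl] prod common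
    by (simp add: gauss_term_def)
  moreover have "(\<lambda>q. series_term a b (Suc n) (split_column n m s q)) summable_on UNIV"
    using summable m s unfolding series_term_summable_iff_split[OF n, symmetric]
    by (intro summable_on_SigmaD1[where x = "(m, s)" and A = "Sigma (families n) (splits n)"
         and f = "\<lambda>(m, s) q. series_term a b (Suc n) (split_column n m s q)", unfolded prod.case])
      (simp_all add: case_prod_unfold)
  ultimately have "gauss_term (b n) (b (Suc n)) a summable_on UNIV"
    by simp
  then have "(\<lambda>q. norm (gauss_term (b n) (b (Suc n)) a q)) summable_on UNIV"
    by (subst (asm) summable_on_iff_abs_summable_on_real)
  then have "summable (\<lambda>q. norm (gauss_term (b n) (b (Suc n)) a q))"
    by (rule summable_on_imp_summable)
  then show ?thesis
    using summable_gauss_term_imp[OF a] by blast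
qed

text \<open>The induction starts at \<open>n = 1\<close>, where there are no index pairs and the series is the single
  term 1.\<close>

lemma series_has_sum:
  assumes a: "a \<notin> \<int>\<^sub>\<le>\<^sub>0" and "n \<ge> 1"
    and "(\<Sum>k = 1..n. b k) < a" and "series_term a b n summable_on families n"
  shows "(series_term a b n has_sum
           Gamma (a - (\<Sum>k = 1..n. b k)) * Gamma a ^ (n - 1) * (\<Prod>k = 1..n. rGamma (a - b k))) (families n)"
  using assms(2-)
proof (induction n arbitrary: b rule: nat_induct_at_least)
  case base
  have "index_pairs 1 = {}"
    by (auto simp: index_pairs_def)
  then have fam: "families 1 = {\<lambda>_. undefined}"
    by (simp add: families_def)
  have "a - b 1 \<notin> \<int>\<^sub>\<le>\<^sub>0"
    using base by (auto elim!: nonpos_Ints_cases)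
  then have "Gamma (a - b 1) * rGamma (a - b 1) = 1"
    by (simp add: Gamma_def rGamma_eq_zero_iff)
  moreover have "series_term a b 1 m = 1" for m
    using \<open>index_pairs 1 = {}\<close> by (simp add: series_term_def A_def B_def)
  ultimately show ?case
    unfolding fam by (simp add: has_sum_finite_iff)
next
  case (Suc n)
  define b' where "b' = b(n := b n + b (Suc n))"
  note conv = convergence_condition[OF a Suc.hyps Suc.prems(2)]
  obtain K R where K: "K * rGamma (a - b n - b (Suc n)) = Gamma a * rGamma (a - b n) * rGamma (a - b (Suc n))"
    and R: "\<And>m s. s \<in> splits n m \<Longrightarrow>
       ((\<lambda>q. series_term a b (Suc n) (split_column n m s q)) has_sum R m s) UNIV"
    and R': "\<And>m. (R m has_sum K * series_term a b' n m) (splits n m)"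
    using reduce_series_term[where a = a and b = b, OF a Suc.hyps conv] unfolding b'_def by blast
  define S where "S = infsum (series_term a b (Suc n)) (families (Suc n))"
  have S: "(series_term a b (Suc n) has_sum S) (families (Suc n))"
    unfolding S_def using Suc.prems(2) by (rule has_sum_infsum)
  then have "((\<lambda>((m, s), q). series_term a b (Suc n) (split_column n m s q)) has_sum S)
       (Sigma (families n) (splits n) \<times> UNIV)"
    using has_sum_reindex_bij_betw[OF bij_betw_split_column[OF Suc.hyps], of "series_term a b (Suc n)"]
    by (simp add: case_prod_unfold)
  from has_sum_SigmaD[OF this, where g = "\<lambda>(m, s). R m s"]
  have "((\<lambda>(m, s). R m s) has_sum S) (Sigma (families n) (splits n))"
    using R by auto
  from has_sum_SigmaD[OF this, where g = "\<lambda>m. K * series_term a b' n m"]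
  have S': "((\<lambda>m. K * series_term a b' n m) has_sum S) (families n)"
    using R' by auto
  have sum: "(\<Sum>k = 1..n. b' k) = (\<Sum>k = 1..Suc n. b k)"
    unfolding b'_def by (rule sum_merge_parameters[OF Suc.hyps])
  define V where "V = Gamma (a - (\<Sum>k = 1..n. b' k)) * Gamma a ^ (n - 1) * (\<Prod>k = 1..n. rGamma (a - b' k))"
  \<comment> \<open>If \<open>K = 0\<close>, then the reduced series need not be summable; it is not needed, because both
    sides vanish.\<close>
  have "S = K * V"
  proof (cases "K = 0")
    case True
    then show ?thesis
      using S' has_sum_unique[OF _ has_sum_0] by fastforce
  next
    case False
    then have "series_term a b' n summable_on families n"
      using has_sum_imp_summable[OF S'] by (simp add: summable_on_cmult_right')
    then have "(series_term a b' n has_sum V) (families n)"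
      unfolding V_def using Suc.prems(1) by (intro Suc.IH) (simp_all only: sum)
    then have "((\<lambda>m. K * series_term a b' n m) has_sum K * V) (families n)"
      by (rule has_sum_cmult_right)
    then show ?thesis
      using has_sum_unique[OF S'] by blast
  qed
  also have "K * V = Gamma (a - (\<Sum>k = 1..Suc n. b k)) * Gamma a ^ (Suc n - 1) * (\<Prod>k = 1..Suc n. rGamma (a - b k))"
  proof -
    obtain l where l: "n = Suc l"
      using Suc.hyps by (cases n) auto
    have "(\<Prod>k = 1..l. rGamma (a - b' k)) = (\<Prod>k = 1..l. rGamma (a - b k))"
      by (intro prod.cong) (auto simp: b'_def l)
    then have "(\<Prod>k = 1..n. rGamma (a - b' k)) = (\<Prod>k = 1..l. rGamma (a - b k)) * rGamma (a - b n - b (Suc n))"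
      by (simp add: l b'_def diff_diff_eq)
    then have "K * V = Gamma (a - (\<Sum>k = 1..Suc n. b k)) * Gamma a ^ (n - 1) * (\<Prod>k = 1..l. rGamma (a - b k))
        * (K * rGamma (a - b n - b (Suc n)))"
      unfolding V_def sum by simp
    also have "\<dots> = Gamma (a - (\<Sum>k = 1..Suc n. b k)) * Gamma a ^ (Suc n - 1) * (\<Prod>k = 1..Suc n. rGamma (a - b k))"
      unfolding K by (simp add: l)
    finally show ?thesis .
  qed
  finally show ?case
    using S by simp
qed

lemma pochhammer_nonneg_of_nonneg:
  fixes x :: real
  assumes "x \<ge> 0"
  shows "pochhammer x k \<ge> 0"
  using assms unfolding pochhammer_prod by (intro prod_nonneg) auto

lemma series_term_nonneg:
  assumes "\<And>k. k \<in> {1..n} \<Longrightarrow> 0 \<le> b k" and "(\<Sum>k = 1..n. b k) < a"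
  shows "series_term a b n m \<ge> 0"
proof -
  have "b k \<le> (\<Sum>k = 1..n. b k)" if "k \<in> {1..n}" for k
    using assms(1) that by (intro member_le_sum) auto
  then have "0 \<le> a - b k" if "k \<in> {1..n}" for k
    using assms(2) that by force
  moreover have "0 \<le> (\<Sum>k = 1..n. b k)"
    using assms(1) by (intro sum_nonneg) auto
  ultimately show ?thesis
    unfolding series_term_def using assms
    by (intro mult_nonneg_nonneg divide_nonneg_nonneg prod_nonneg pochhammer_nonneg_of_nonneg) auto
qed

lemma series_summable_nonneg:
  assumes "n \<ge> 1" "\<And>k. k \<in> {1..n} \<Longrightarrow> 0 \<le> b k" and "(\<Sum>k = 1..n. b k) < a"
  shows "series_term a b n summable_on families n"
  using assms
proof (induction n arbitrary: b rule: nat_induct_at_least)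
  case base
  have "index_pairs 1 = {}"
    by (auto simp: index_pairs_def)
  then show ?case
    by (simp add: families_def)
next
  case (Suc n)
  define b' where "b' = b(n := b n + b (Suc n))"
  have a: "a \<notin> \<int>\<^sub>\<le>\<^sub>0"
    using Suc.prems sum_nonneg[of "{1..Suc n}" b] by (auto elim!: nonpos_Ints_cases)
  have sum: "(\<Sum>k = 1..n. b' k) = (\<Sum>k = 1..Suc n. b k)"
    unfolding b'_def by (rule sum_merge_parameters[OF Suc.hyps])
  have b'_nonneg: "0 \<le> b' k" if "k \<in> {1..n}" for k
    using Suc.prems(1) that by (auto simp: b'_def)
  have "b' n \<le> (\<Sum>k = 1..n. b' k)"
    using b'_nonneg Suc.hyps by (intro member_le_sum) auto
  then have conv: "b n \<in> \<int>\<^sub>\<le>\<^sub>0 \<or> b (Suc n) \<in> \<int>\<^sub>\<le>\<^sub>0 \<or> b n + b (Suc n) < a"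
    using Suc.prems(2) unfolding sum by (simp add: b'_def)
  obtain K R where "K * rGamma (a - b n - b (Suc n)) = Gamma a * rGamma (a - b n) * rGamma (a - b (Suc n))"
    and R: "\<And>m s. s \<in> splits n m \<Longrightarrow>
       ((\<lambda>q. series_term a b (Suc n) (split_column n m s q)) has_sum R m s) UNIV"
    and R': "\<And>m. (R m has_sum K * series_term a b' n m) (splits n m)"
    using reduce_series_term[where a = a and b = b, OF a Suc.hyps conv] unfolding b'_def by blast
  note nonneg = series_term_nonneg[where b = b and n = "Suc n", OF Suc.prems]
  have "series_term a b' n summable_on families n"
    using b'_nonneg Suc.prems(2) by (intro Suc.IH) (auto simp only: sum)
  then have "(\<lambda>m. K * series_term a b' n m) summable_on families n"
    by (rule summable_on_cmult_right)
  then have "(\<lambda>(m, s). R m s) summable_on Sigma (families n) (splits n)"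
    by (rule summable_on_SigmaI[rotated]) (use R' has_sum_nonneg[OF R nonneg] in auto)
  then have "(\<lambda>((m, s), q). series_term a b (Suc n) (split_column n m s q)) summable_on
           Sigma (families n) (splits n) \<times> UNIV"
    by (rule summable_on_SigmaI[rotated]) (use R nonneg in auto)
  then show ?case
    unfolding series_term_summable_iff_split[OF Suc.hyps] .
qed

lemma series_summable_two:
  assumes a: "a \<notin> \<int>\<^sub>\<le>\<^sub>0" and "b 1 + b 2 < a"
  shows "series_term a b 2 summable_on families 2"
proof -
  have "index_pairs 1 = {}"
    by (auto simp: index_pairs_def)
  then have fin: "finite (Sigma (families 1) (splits 1))"
    by (auto simp: families_def splits_def intro!: finite_SigmaI finite_PiE)
  have "b 1 \<in> \<int>\<^sub>\<le>\<^sub>0 \<or> b (Suc 1) \<in> \<int>\<^sub>\<le>\<^sub>0 \<or> b 1 + b (Suc 1) < a"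
    using assms(2) by (simp add: numeral_2_eq_2)
  from reduce_series_term[where a = a and b = b and n = 1, OF a order.refl this]
  obtain K R where "K * rGamma (a - b 1 - b (Suc 1)) = Gamma a * rGamma (a - b 1) * rGamma (a - b (Suc 1))"
    and "\<And>m s. s \<in> splits 1 m \<Longrightarrow>
       ((\<lambda>q. series_term a b (Suc 1) (split_column 1 m s q)) has_sum R m s) UNIV"
    and "\<And>m. (R m has_sum K * series_term a (b(1 := b 1 + b (Suc 1))) 1 m) (splits 1 m)"
    by blast
  then have R: "((\<lambda>q. series_term a b 2 (split_column 1 m s q)) has_sum R m s) UNIV" if "s \<in> splits 1 m" for m s
    using that by (simp add: numeral_2_eq_2)
  have inner: "(\<lambda>q. norm (series_term a b 2 (split_column 1 m s q))) summable_on UNIV"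
    if "s \<in> splits 1 m" for m s
    using has_sum_imp_summable[OF R[OF that]] by (subst (asm) summable_on_iff_abs_summable_on_real)
  have "(\<lambda>((m, s), q). series_term a b 2 (split_column 1 m s q)) summable_on
           Sigma (families 1) (splits 1) \<times> UNIV"
    by (subst summable_on_iff_abs_summable_on_real, subst Infinite_Sum.abs_summable_on_Sigma_iff)
       (use fin inner in \<open>auto simp del: real_norm_def\<close>)
  then show ?thesis
    using series_term_summable_iff_split[of 1 a b] by (simp add: numeral_2_eq_2)
qed

theorem lemma2:
  fixes a :: real and b :: "nat \<Rightarrow> real" and n :: nat
  assumes "n \<ge> 2"
    and "a \<notin> \<int>\<^sub>\<le>\<^sub>0"
    and "a > (\<Sum>k = 1..n. b k)"
    and "n = 2 \<or> (\<forall>k\<in>{1..n}. 0 \<le> b k) \<or> series_term a b n summable_on families n"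
  shows "(series_term a b n has_sum
           Gamma (a - (\<Sum>k = 1..n. b k)) * Gamma a ^ (n - 1) / (\<Prod>k = 1..n. Gamma (a - b k)))
         (families n)"
proof -
  have "series_term a b n summable_on families n"
    using assms(4)
  proof (elim disjE)
    assume "n = 2"
    then show ?thesis
      using series_summable_two[OF assms(2), of b] assms(3) by (simp add: numeral_2_eq_2)
  next
    assume "\<forall>k\<in>{1..n}. 0 \<le> b k"
    then show ?thesis
      using assms(1,3) by (intro series_summable_nonneg) auto
  qed
  then have "(series_term a b n has_sum
       Gamma (a - (\<Sum>k = 1..n. b k)) * Gamma a ^ (n - 1) * (\<Prod>k = 1..n. rGamma (a - b k))) (families n)"
    using assms(1-3) by (intro series_has_sum) auto
  then show ?thesis
    by (simp add: rGamma_inverse_Gamma divide_inverse prod_inversef[unfolded o_def])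
qed

end
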